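(* If $2\le n' < n$, and $T\not\cong S_n$ is a tree of order $n$, then $$n' \leq \nabla(T\,\square\, S_{n'}) \leq n-1.$$
   Context: Here $n,n'$ are integers. The order of a graph is its number of vertices. $S_n$ denotes the star $K_{1,n-1}$ on $n$ vertices, and $\cong$ denotes graph isomorphism. A decycling set of a graph $G$ is a set $S\subseteq V(G)$ such that the subgraph of $G$ induced by $V(G)\setminus S$ is a forest (contains no cycle). The decycling number $\nabla(G)$ is the minimum cardinality of a decycling set of $G$. The Cartesian product $G \,\square\, H$ has vertex set $V(G)\times V(H)$, and two vertices $(g,h)$ and $(g',h')$ are adjacent if either $g=g'$ and $hh'\in E(H)$, or $gg'\in E(G)$ and $h=h'$. *)

theory Defs
  imports "Graph_Theory.Graph_Theory"
begin

text \<open>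
  As in the Graph_Theory library, a finite simple graph is a finite symmetric digraph without loops
  and parallel arcs (locale \<^locale>\<open>graph\<close>; for \<^typ>\<open>'a pair_pre_digraph\<close>, locale
  \<^locale>\<open>pair_graph\<close>).  The library predicates for forests and trees are directed notions: they count
  the closed walk a, b, a as a cycle, so a symmetric digraph with an edge is never a forest there.
  Undirected cycles are therefore taken to be the library's cycles of length at least 3.
\<close>

definition undirected_cycle :: "('a,'b) pre_digraph \<Rightarrow> 'b awalk \<Rightarrow> bool" where
  "undirected_cycle G p \<longleftrightarrow> pre_digraph.cycle G p \<and> 3 \<le> length p"

definition undirected_forest :: "('a,'b) pre_digraph \<Rightarrow> bool" where
  "undirected_forest G \<longleftrightarrow> graph G \<and> (\<nexists>p. undirected_cycle G p)"

definition undirected_tree :: "('a,'b) pre_digraph \<Rightarrow> bool" where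
  "undirected_tree G \<longleftrightarrow> undirected_forest G \<and> Digraph_Component.connected G"

definition decycling_set :: "('a,'b) pre_digraph \<Rightarrow> 'a set \<Rightarrow> bool" where
  "decycling_set G S \<longleftrightarrow> S \<subseteq> verts G \<and> undirected_forest (G \<restriction> (verts G - S))"

definition decycling_number :: "('a,'b) pre_digraph \<Rightarrow> nat" where
  "decycling_number G = (LEAST k. \<exists>S. decycling_set G S \<and> finite S \<and> card S = k)"

definition cartesian_product ::
    "'a pair_pre_digraph \<Rightarrow> 'b pair_pre_digraph \<Rightarrow> ('a \<times> 'b) pair_pre_digraph" (infixl \<open>\<box>\<close> 70) where
  "G \<box> H = \<lparr> pverts = pverts G \<times> pverts H,
     parcs = {((g, h), (g', h')) | g h g' h'.
       g = g' \<and> g \<in> pverts G \<and> (h, h') \<in> parcs H \<or>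
       (g, g') \<in> parcs G \<and> h = h' \<and> h \<in> pverts H} \<rparr>"

text \<open>The star on the vertices 0, ..., n - 1 with centre 0.\<close>

definition star :: "nat \<Rightarrow> nat pair_pre_digraph" where
  "star n = \<lparr> pverts = {..<n}, parcs = {0} \<times> {1..<n} \<union> {1..<n} \<times> {0} \<rparr>"

lemma star_complete_bipartite:
  assumes "1 \<le> n"
  shows "K\<^bsub>1,n-1\<^esub> (with_proj (star n))"
proof -
  have "{..<n} = {0} \<union> {1..<n}"
    using assms by auto
  then show ?thesis
    unfolding complete_bipartite_digraph_pair_def
    by (intro conjI exI[of _ "{0::nat}"] exI[of _ "{1..<n}"]) (simp_all add: star_def)
qed

lemma pair_graph_star: "1 \<le> n \<Longrightarrow> pair_graph (star n)"
  using star_complete_bipartite pair_graphI_complete_bipartite by blast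

lemma pair_graph_cartesian_product:
  assumes "pair_graph G" "pair_graph H"
  shows "pair_graph (G \<box> H)"
proof -
  interpret G: pair_graph G by fact
  interpret H: pair_graph H by fact
  have sub: "parcs (G \<box> H) \<subseteq> (pverts G \<times> pverts H) \<times> (pverts G \<times> pverts H)"
    by (auto simp: cartesian_product_def dest: G.wellformed' H.wellformed')
  have verts: "pverts (G \<box> H) = pverts G \<times> pverts H"
    by (simp add: cartesian_product_def)
  have fin: "finite (pverts G \<times> pverts H)"
    by simp
  show ?thesis
  proof
    show "finite (parcs (G \<box> H))"
      by (rule finite_subset[OF sub]) (use fin in blast)
    show "symmetric (with_proj (G \<box> H))"
      unfolding symmetric_def
      by (rule symI)
        (auto simp: cartesian_product_def intro: G.arcs_symmetric H.arcs_symmetric)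
  next
    fix e assume e: "e \<in> parcs (G \<box> H)"
    show "fst e \<in> pverts (G \<box> H)" "snd e \<in> pverts (G \<box> H)"
      using e sub verts by auto
    show "fst e \<noteq> snd e"
      using e by (auto simp: cartesian_product_def dest: G.no_loops' H.no_loops')
  qed (use fin verts in auto)
qed

lemma (in graph) decycling_set_verts: "decycling_set G (verts G)"
proof -
  interpret E: wf_digraph "G \<restriction> {}"
    by unfold_locales auto
  have "graph (G \<restriction> {})"
    by unfold_locales (auto simp: symmetric_conv)
  moreover have "\<not> E.cycle p" for p
    by (auto simp: E.cycle_def E.awalk_def)
  ultimately show ?thesis
    by (simp add: decycling_set_def undirected_forest_def undirected_cycle_def)
qed

lemma (in graph) decycling_number_attained:
  "\<exists>S. decycling_set G S \<and> card S = decycling_number G"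
proof -
  have "\<exists>k S. decycling_set G S \<and> finite S \<and> card S = k"
    using decycling_set_verts finite_verts by blast
  from LeastI_ex[OF this] show ?thesis
    unfolding decycling_number_def by blast
qed

end

theory Submission
  imports Defs
begin

text \<open>
  Call the copy of \<open>T\<close> over the centre \<open>0\<close> of the star the central layer and the other \<open>n' - 1\<close>
  copies the outer layers.

  Upper bound: delete the central layer except for one vertex \<open>(v, 0)\<close>.  What is left consists of
  the outer layers, each a copy of \<open>T\<close>, joined through \<open>(v, 0)\<close>, which is attached to each of them by
  a single edge.  Attaching trees to a common vertex in this way creates no cycle
  (\<open>decycling_set_central_layer\<close>).

  Lower bound: let \<open>S\<close> be a decycling set and \<open>S\<^sub>i\<close> its part in layer \<open>i\<close>.  Every edge of \<open>T\<close>
  spans a 4-cycle between the central layer and any outer layer \<open>i\<close>, so \<open>S\<^sub>0 \<union> S\<^sub>i\<close> covers all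
  edges of \<open>T\<close> (\<open>decycling_set_covers\<close>), and a vertex cover of \<open>T\<close> has at least two elements because
  \<open>T\<close> is not a star (\<open>star_if_small_cover\<close>).  Distinguish by the number of outer layers that \<open>S\<close>
  misses.
  \<^item> None is missed: if \<open>S\<^sub>0\<close> is nonempty, there is one vertex per layer; otherwise each outer layer
    contains a cover, and \<open>2 * (n' - 1) \<ge> n'\<close>.
  \<^item> One is missed: then \<open>S\<^sub>0\<close> itself is a cover, and its two vertices make up for the missed layer.
  \<^item> Two are missed: two vertices of the central layer outside \<open>S\<close> would be joined by a path through
    either of the missed layers, which gives a cycle; hence \<open>S\<^sub>0\<close> already has at least \<open>n - 1 \<ge> n'\<close> vertices
    (\<open>decycling_set_two_missed_layers\<close>).
\<close>

section \<open>Cycles as vertex lists\<close>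

text \<open>
  In a graph without parallel arcs a cycle is determined by its sequence of vertices; without the repetition of
  the first vertex at the end, the list can be rotated so that it starts at any vertex of the cycle.
\<close>

definition vertex_cycle :: "'a rel \<Rightarrow> 'a list \<Rightarrow> bool" where
  "vertex_cycle R vs \<longleftrightarrow>
    3 \<le> length vs \<and> distinct vs \<and> successively (\<lambda>x y. (x, y) \<in> R) (vs @ [hd vs])"

lemma vertex_cycle_rotate:
  assumes "vertex_cycle R (xs @ ys)"
  shows "vertex_cycle R (ys @ xs)"
proof (cases "xs = [] \<or> ys = []")
  case False
  then show ?thesis
    using assms by (auto simp: vertex_cycle_def successively_append_iff)
qed (use assms in auto)

text \<open>A list with a single entry carries no arc that would force the entry into \<open>U\<close>.\<close>

lemma successively_Restr:
  assumes "2 \<le> length xs"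
  shows "successively (\<lambda>x y. (x, y) \<in> Restr R U) xs \<longleftrightarrow>
    set xs \<subseteq> U \<and> successively (\<lambda>x y. (x, y) \<in> R) xs"
  using assms
proof (induction xs rule: induct_list012)
  case (3 x y zs)
  then show ?case by (cases zs) auto
qed simp_all

lemma vertex_cycle_Restr:
  "vertex_cycle (Restr R U) vs \<longleftrightarrow> vertex_cycle R vs \<and> set vs \<subseteq> U"
proof (cases "3 \<le> length vs")
  case True
  then have "set (vs @ [hd vs]) = set vs"
    by (cases vs) auto
  then show ?thesis
    using True successively_Restr[of "vs @ [hd vs]" R U] by (auto simp: vertex_cycle_def)
qed (simp add: vertex_cycle_def)

lemma pcas_imp_successively:
  assumes "pcas u p w" "set p \<subseteq> R"
  shows "pawalk_verts u p = map fst p @ [w]"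
    and "successively (\<lambda>x y. (x, y) \<in> R) (map fst p @ [w])"
  using assms
proof (induction p arbitrary: u)
  case (Cons e p)
  {
    case 1 then show ?case using Cons by auto
  next
    case 2
    then have "pcas (snd e) p w" by simp
    then have "hd (map fst p @ [w]) = snd e" by (cases p) auto
    then show ?case using 2 Cons by (auto simp: successively_Cons)
  }
qed simp_all

lemma vwalk_arcs_props:
  assumes "ws \<noteq> []"
  shows "pcas (hd ws) (vwalk_arcs ws) (last ws)"
    and "pawalk_verts (hd ws) (vwalk_arcs ws) = ws"
    and "set (vwalk_arcs ws) \<subseteq> R \<longleftrightarrow> successively (\<lambda>x y. (x, y) \<in> R) ws"
    and "length (vwalk_arcs ws) = length ws - 1"
  using assms by (induction ws rule: induct_list012) auto

lemma undirected_cycle_iff_vertex_cycle: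
  assumes "pair_wf_digraph G"
  shows "(\<exists>p. undirected_cycle (with_proj G) p) \<longleftrightarrow> (\<exists>vs. vertex_cycle (parcs G) vs)"
proof
  interpret pair_wf_digraph G by fact
  {
    assume "\<exists>p. undirected_cycle (with_proj G) p"
    then obtain p u where p: "set p \<subseteq> parcs G" "pcas u p u" "3 \<le> length p"
      and dist: "distinct (tl (pawalk_verts u p))"
      by (auto simp: undirected_cycle_def cycle_def awalk_def)
    from p(3) obtain e q where e: "p = e # q" by (cases p) auto
    have "fst e = u" using p(2) e by simp
    moreover have "distinct (map fst q @ [u])"
      using dist pcas_imp_successively(1)[OF p(2,1)] e by auto
    ultimately have "vertex_cycle (parcs G) (map fst p)"
      using p(3) e pcas_imp_successively(2)[OF p(2,1)] by (auto simp: vertex_cycle_def)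
    then show "\<exists>vs. vertex_cycle (parcs G) vs" ..
  next
    assume "\<exists>vs. vertex_cycle (parcs G) vs"
    then obtain vs where vs: "vertex_cycle (parcs G) vs" ..
    then obtain x xs where x: "vs = x # xs" by (cases vs) (auto simp: vertex_cycle_def)
    let ?p = "vwalk_arcs (vs @ [x])"
    note props = vwalk_arcs_props[of "vs @ [x]", simplified]
    have succ: "successively (\<lambda>x y. (x, y) \<in> parcs G) (vs @ [x])"
      using vs x by (simp add: vertex_cycle_def)
    have sub: "set ?p \<subseteq> parcs G" using props(3) succ by blast
    have "x \<in> pverts G"
      using vs x by (cases xs) (auto simp: vertex_cycle_def dest: wellformed')
    then have "awalk x ?p x" using sub props(1) x by (simp add: awalk_def)
    moreover have "distinct (tl (pawalk_verts x ?p))"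
      using props(2) vs x by (auto simp: vertex_cycle_def)
    moreover have "3 \<le> length ?p" using vs props(4) by (simp add: vertex_cycle_def)
    ultimately have "undirected_cycle (with_proj G) ?p"
      unfolding undirected_cycle_def cycle_def by auto
    then show "\<exists>p. undirected_cycle (with_proj G) p" ..
  }
qed

lemma undirected_forest_iff_vertex_cycle:
  assumes "pair_graph G"
  shows "undirected_forest (with_proj G) \<longleftrightarrow> (\<nexists>vs. vertex_cycle (parcs G) vs)"
proof -
  interpret pair_graph G by fact
  show ?thesis
    using undirected_cycle_iff_vertex_cycle[of G] pair_wf_digraph pair_graphD_graph
    by (simp add: undirected_forest_def)
qed

lemma decycling_set_iff_vertex_cycle:
  assumes "pair_graph G"
  shows "decycling_set (with_proj G) S \<longleftrightarrow>
    S \<subseteq> pverts G \<and> (\<forall>vs. vertex_cycle (parcs G) vs \<longrightarrow> set vs \<subseteq> pverts G \<longrightarrow> set vs \<inter> S \<noteq> {})"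
proof -
  interpret pair_graph G by fact
  let ?U = "pverts G - S"
  let ?H = "\<lparr>pverts = ?U, parcs = Restr (parcs G) ?U\<rparr>"
  have H: "with_proj G \<restriction> ?U = with_proj ?H"
    by (intro pre_digraph.equality) auto
  have "pair_graph ?H"
  proof
    show "symmetric (with_proj ?H)"
      unfolding symmetric_def by (rule symI) (auto intro: arcs_symmetric)
  qed (auto dest: no_loops')
  from undirected_forest_iff_vertex_cycle[OF this] H show ?thesis
    unfolding decycling_set_def by (auto simp: vertex_cycle_Restr)
qed

section \<open>Connected graphs with a small vertex cover\<close>

lemma connected_imp_distinct_walk:
  assumes "pair_graph G" "Digraph_Component.connected (with_proj G)"
    and "a \<in> pverts G" "b \<in> pverts G"
  obtains P where "P \<noteq> []" "hd P = a" "last P = b" "distinct P" "set P \<subseteq> pverts G"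
    "successively (\<lambda>x y. (x, y) \<in> parcs G) P"
proof -
  interpret pair_graph G by fact
  have "mk_symmetric (with_proj G) = G"
    by (rule pair_pre_digraph.equality) (auto simp: mk_symmetric_def dest: arcs_symmetric)
  then have "a \<rightarrow>\<^sup>*\<^bsub>with_proj G\<^esub> b"
    using assms by (simp add: connected_def strongly_connected_def)
  then obtain P where "vpath P (with_proj G)" "hd P = a" "last P = b"
    by (auto simp: reachable_vpath_conv)
  then show thesis
    using that[of P] vwalk_arcs_props(3)[of P "parcs G"] by (auto simp: vpath_def vwalk_def)
qed

text \<open>
  By connectedness every vertex other than the covering one has a neighbour, and this can only be
  the covering vertex.
\<close>

lemma star_if_small_cover:
  fixes T :: "'a pair_pre_digraph"
  assumes T: "pair_graph T" "Digraph_Component.connected (with_proj T)"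
    and n: "card (pverts T) = n" "2 \<le> n"
    and C: "finite C" "card C \<le> 1" "C \<subseteq> pverts T"
    and cover: "\<And>u v. (u, v) \<in> parcs T \<Longrightarrow> u \<in> C \<or> v \<in> C"
  shows "digraph_iso (with_proj T) (with_proj (star n))"
proof -
  interpret pair_graph T by fact
  have "pverts T \<noteq> {}" using n by auto
  then obtain c where c: "c \<in> pverts T" "C \<subseteq> {c}"
    using C by (metis card_le_Suc0_iff_eq One_nat_def all_not_in_conv insert_iff subset_iff)
  have spoke: "(c, w) \<in> parcs T" if w: "w \<in> pverts T" "w \<noteq> c" for w
  proof -
    obtain P where P: "P \<noteq> []" "hd P = w" "last P = c" "successively (\<lambda>x y. (x, y) \<in> parcs T) P"
      using connected_imp_distinct_walk[OF T w(1) c(1)] by metis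
    then obtain x xs where "P = w # x # xs"
      using w(2) by (metis last.simps list.sel(1) list.exhaust)
    then have "(w, x) \<in> parcs T" using P by simp
    moreover from this have "x = c" using cover c(2) w(2) by blast
    ultimately show ?thesis using arcs_symmetric by blast
  qed
  have arcs: "parcs T = {c} \<times> (pverts T - {c}) \<union> (pverts T - {c}) \<times> {c}"
  proof (intro equalityI subsetI)
    fix e assume e: "e \<in> parcs T"
    obtain u v where uv: "e = (u, v)" by (cases e)
    then have "u = c \<or> v = c" "u \<noteq> v" "u \<in> pverts T" "v \<in> pverts T"
      using e cover[of u v] c(2) no_loops'[of u v] wellformed'[of u v] by auto
    then show "e \<in> {c} \<times> (pverts T - {c}) \<union> (pverts T - {c}) \<times> {c}" using uv by auto
  qed (auto intro: spoke arcs_symmetric)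
  have "card (pverts T - {c}) = card {1..<n}" using n c by simp
  then obtain g where g: "bij_betw g (pverts T - {c}) {1..<n}"
    using finite_same_card_bij[of "pverts T - {c}" "{1..<n}"] by auto
  define f where "f = g(c := 0)"
  have fc: "f c = 0" by (simp add: f_def)
  have f_img: "f ` (pverts T - {c}) = {1..<n}"
    using g by (auto simp: f_def bij_betw_def)
  have f_verts: "f ` pverts T = {..<n}"
  proof -
    have "f ` pverts T = insert (f c) (f ` (pverts T - {c}))" using c by blast
    then show ?thesis using fc f_img n by auto
  qed
  have inj: "inj_on f (pverts T)"
    using f_verts n by (intro eq_card_imp_inj_on) auto
  let ?hom = "\<lparr>iso_verts = f, iso_arcs = map_prod f f, iso_head = snd, iso_tail = fst\<rparr>"
  have sub: "parcs T \<subseteq> pverts T \<times> pverts T" by (auto dest: wellformed')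
  have "inj_on (map_prod f f) (parcs T)"
    by (rule inj_on_subset[OF map_prod_inj_on[OF inj inj] sub])
  then have "digraph_isomorphism ?hom"
    unfolding digraph_isomorphism_def using inj wf_digraph_axioms by simp
  moreover have "map_prod f f ` parcs T = {0} \<times> {1..<n} \<union> {1..<n} \<times> {0}"
    using map_prod_surj_on[OF _ f_img, of f "{c}" "{0}"] map_prod_surj_on[OF f_img, of f "{c}" "{0}"]
    unfolding arcs image_Un by (simp add: fc)
  then have "with_proj (star n) = app_iso ?hom (with_proj T)"
    by (intro pre_digraph.equality) (auto simp: star_def f_verts)
  ultimately show ?thesis unfolding digraph_iso_def by blast
qed

section \<open>Products with a star\<close>

lemma pverts_product_star [simp]: "pverts (T \<box> star m) = pverts T \<times> {..<m}"
  by (simp add: cartesian_product_def star_def)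

lemma arc_product_star_iff:
  "((u, i), (v, j)) \<in> parcs (T \<box> star m) \<longleftrightarrow>
    u = v \<and> u \<in> pverts T \<and> (i = 0 \<and> 1 \<le> j \<and> j < m \<or> j = 0 \<and> 1 \<le> i \<and> i < m) \<or>
    (u, v) \<in> parcs T \<and> i = j \<and> i < m"
  by (auto simp: cartesian_product_def star_def)

lemma successively_layer:
  assumes "successively (\<lambda>x y. (x, y) \<in> parcs T) P" "i < m"
  shows "successively (\<lambda>x y. (x, y) \<in> parcs (T \<box> star m)) (map (\<lambda>w. (w, i)) P)"
  using assms(1) unfolding successively_map
  by (rule successively_mono) (simp add: arc_product_star_iff assms(2))

text \<open>Distinct outer layers are connected only through the central layer.\<close>

lemma outer_walk_in_layer:
  assumes "successively (\<lambda>x y. (x, y) \<in> parcs (T \<box> star m)) ws" "\<forall>x\<in>set ws. snd x \<noteq> 0"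
  shows "\<exists>i P. ws = map (\<lambda>w. (w, i)) P \<and> successively (\<lambda>x y. (x, y) \<in> parcs T) P"
  using assms
proof (induction ws rule: induct_list012)
  case (2 x)
  show ?case by (intro exI[of _ "snd x"] exI[of _ "[fst x]"]) simp
next
  case (3 x y zs)
  then have tail: "successively (\<lambda>x y. (x, y) \<in> parcs (T \<box> star m)) (y # zs)"
    "\<forall>x\<in>set (y # zs). snd x \<noteq> 0"
    by simp_all
  obtain i P
    where P: "y # zs = map (\<lambda>w. (w, i)) P" "successively (\<lambda>x y. (x, y) \<in> parcs T) P"
    using "3.IH"(2)[OF tail] by (elim exE conjE)
  obtain u j where x: "x = (u, j)" by (cases x)
  obtain v P' where P': "P = v # P'" "y = (v, i)" using P(1) by (cases P) auto
  have "j = i" "(u, v) \<in> parcs T"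
    using 3 x P' by (auto simp: arc_product_star_iff)
  then have "x # y # zs = map (\<lambda>w. (w, i)) (u # P)" "successively (\<lambda>x y. (x, y) \<in> parcs T) (u # P)"
    using P P' x by auto
  then show ?case by (intro exI conjI)
qed simp

text \<open>
  After the deletion, a cycle that avoids \<open>(v, 0)\<close> stays in one layer and projects to a cycle of the forest \<open>T\<close>.  A cycle
  through \<open>(v, 0)\<close> leaves it to a layer \<open>i\<close> and returns from the same layer; both times it uses the
  vertex \<open>(v, i)\<close>, the only neighbour of \<open>(v, 0)\<close> there, so it has length 2.
\<close>

lemma decycling_set_central_layer:
  assumes T: "pair_graph T" "undirected_forest (with_proj T)" and "1 \<le> m"
  shows "decycling_set (with_proj (T \<box> star m)) ((pverts T - {v}) \<times> {0})"
proof -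
  let ?R = "\<lambda>x y. (x, y) \<in> parcs (T \<box> star m)"
  have False if vs: "vertex_cycle (parcs (T \<box> star m)) vs" "set vs \<subseteq> pverts T \<times> {..<m}"
    "set vs \<inter> (pverts T - {v}) \<times> {0} = {}" for vs
  proof (cases "(v, 0) \<in> set vs")
    case False
    have ne: "vs \<noteq> []" using vs(1) by (auto simp: vertex_cycle_def)
    have outer: "\<forall>x\<in>set (vs @ [hd vs]). snd x \<noteq> 0"
    proof -
      have "snd x \<noteq> 0" if "x \<in> set vs" for x
        using that vs(2,3) False by (metis (no_types, lifting) DiffI IntI SigmaI empty_iff
            mem_Sigma_iff singletonD singletonI prod.collapse subsetD)
      then show ?thesis using ne by auto
    qed
    obtain i P where P: "vs @ [hd vs] = map (\<lambda>w. (w, i)) P" "successively (\<lambda>x y. (x, y) \<in> parcs T) P"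
      using outer_walk_in_layer[OF _ outer] vs(1) unfolding vertex_cycle_def by blast
    obtain Q x where Q: "P = Q @ [x]" using P(1) by (cases P rule: rev_cases) auto
    have Q': "vs = map (\<lambda>w. (w, i)) Q" "hd vs = (x, i)" using P(1) Q by auto
    then have "x = hd Q" using ne by (auto simp: hd_map)
    moreover have "distinct Q" "3 \<le> length Q"
      using vs(1) Q'(1) by (auto simp: vertex_cycle_def distinct_map)
    ultimately have "vertex_cycle (parcs T) Q"
      using P(2) Q by (simp add: vertex_cycle_def)
    then show False using undirected_forest_iff_vertex_cycle[OF T(1)] T(2) by blast
  next
    case True
    then obtain xs ys where split: "vs = xs @ (v, 0) # ys" by (meson split_list)
    let ?ws = "ys @ xs"
    have cyc: "vertex_cycle (parcs (T \<box> star m)) ((v, 0) # ?ws)"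
      using vertex_cycle_rotate[of _ xs "(v, 0) # ys"] vs(1) split by simp
    then have ws: "2 \<le> length ?ws" "distinct ?ws" "(v, 0) \<notin> set ?ws"
      "successively ?R ?ws" "?R (v, 0) (hd ?ws)" "?R (last ?ws) (v, 0)"
      by (auto simp: vertex_cycle_def successively_append_iff successively_Cons hd_append
          split: if_splits)
    have "\<forall>x\<in>set ?ws. snd x \<noteq> 0"
    proof
      fix x assume "x \<in> set ?ws"
      then have "x \<in> set vs" "x \<noteq> (v, 0)" using split ws(3) by auto
      then show "snd x \<noteq> 0"
        using vs(2,3) by (metis (no_types, lifting) DiffI IntI SigmaI empty_iff
            mem_Sigma_iff singletonD singletonI prod.collapse subsetD)
    qed
    then obtain i P where P: "?ws = map (\<lambda>w. (w, i)) P"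
      using outer_walk_in_layer[OF ws(4)] by blast
    have len: "2 \<le> length P" using ws(1) P by (metis length_map)
    then have "P \<noteq> []" by auto
    moreover from this have "i \<noteq> 0"
      using P \<open>\<forall>x\<in>set ?ws. snd x \<noteq> 0\<close> by (cases P) auto
    ultimately have "hd P = v" "last P = v"
      using ws(5,6) unfolding P by (auto simp: hd_map last_map arc_product_star_iff)
    moreover have "distinct P" using ws(2) unfolding P distinct_map by blast
    ultimately show False using len by (cases P) (auto split: if_splits)
  qed
  moreover have "pair_graph (T \<box> star m)"
    using pair_graph_cartesian_product[OF T(1) pair_graph_star] assms(3) by simp
  ultimately show ?thesis
    using assms(3) by (subst decycling_set_iff_vertex_cycle) auto
qed

lemma decycling_number_le_card:
  assumes "decycling_set G S" "finite S"
  shows "decycling_number G \<le> card S"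
  unfolding decycling_number_def using assms by (intro Least_le) auto

lemma decycling_set_covers:
  assumes T: "pair_graph T" and S: "decycling_set (with_proj (T \<box> star m)) S"
    and i: "1 \<le> i" "i < m" and uv: "(u, v) \<in> parcs T"
  shows "(u, 0) \<in> S \<or> (v, 0) \<in> S \<or> (u, i) \<in> S \<or> (v, i) \<in> S"
proof -
  interpret pair_graph T by fact
  let ?vs = "[(u, 0), (v, 0), (v, i), (u, i)]"
  have "u \<in> pverts T" "v \<in> pverts T" "u \<noteq> v" "(v, u) \<in> parcs T"
    using uv by (auto dest: wellformed' no_loops' arcs_symmetric)
  then have "vertex_cycle (parcs (T \<box> star m)) ?vs" "set ?vs \<subseteq> pverts (T \<box> star m)"
    using uv i by (auto simp: vertex_cycle_def arc_product_star_iff)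
  moreover have "pair_graph (T \<box> star m)"
    using pair_graph_cartesian_product[OF T pair_graph_star] i by simp
  ultimately have "set ?vs \<inter> S \<noteq> {}" using S decycling_set_iff_vertex_cycle by blast
  then show ?thesis by auto
qed

text \<open>
  A path from \<open>a\<close> to \<open>b\<close> can be followed in layer \<open>i\<close> and back in layer \<open>j\<close>, changing between
  them through \<open>(b, 0)\<close> and \<open>(a, 0)\<close>.
\<close>

lemma decycling_set_two_missed_layers:
  assumes T: "pair_graph T" "Digraph_Component.connected (with_proj T)"
    and S: "decycling_set (with_proj (T \<box> star m)) S"
    and ij: "1 \<le> i" "i < m" "1 \<le> j" "j < m" "i \<noteq> j"
    and missed: "\<And>w. (w, i) \<notin> S" "\<And>w. (w, j) \<notin> S"
    and ab: "a \<in> pverts T" "b \<in> pverts T" "(a, 0) \<notin> S" "(b, 0) \<notin> S"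
  shows "a = b"
proof (rule ccontr)
  assume "a \<noteq> b"
  interpret pair_graph T by fact
  obtain P where P: "P \<noteq> []" "hd P = a" "last P = b" "distinct P" "set P \<subseteq> pverts T"
    "successively (\<lambda>x y. (x, y) \<in> parcs T) P"
    using connected_imp_distinct_walk[OF T ab(1,2)] by metis
  have rev: "successively (\<lambda>x y. (x, y) \<in> parcs T) (rev P)"
    unfolding successively_rev using P(6) by (rule successively_mono) (rule arcs_symmetric)
  let ?up = "map (\<lambda>w. (w, i)) P" and ?down = "map (\<lambda>w. (w, j)) (rev P)"
  let ?vs = "(a, 0) # ?up @ (b, 0) # ?down"
  have "vertex_cycle (parcs (T \<box> star m)) ?vs"
    unfolding vertex_cycle_def
  proof (intro conjI)
    show "3 \<le> length ?vs" using P(1) by (cases P) auto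
    show "distinct ?vs" using P(4) ij \<open>a \<noteq> b\<close> by (auto simp: distinct_map inj_on_def)
    show "successively (\<lambda>x y. (x, y) \<in> parcs (T \<box> star m)) (?vs @ [hd ?vs])"
      using P(1-3) ij ab successively_layer[OF P(6) ij(2)] successively_layer[OF rev ij(4)]
      by (auto simp: successively_append_iff successively_Cons arc_product_star_iff
          hd_map last_map hd_rev last_rev simp del: successively_rev)
  qed
  moreover have "set ?vs \<subseteq> pverts (T \<box> star m)" using P(5) ij ab by auto
  moreover have "pair_graph (T \<box> star m)"
    using pair_graph_cartesian_product[OF T(1) pair_graph_star] ij by simp
  ultimately have "set ?vs \<inter> S \<noteq> {}" using S decycling_set_iff_vertex_cycle by blast
  then show False using missed ab by auto
qed

lemma card_eq_sum_card_layers: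
  assumes "finite V" "S \<subseteq> V \<times> {..<m::nat}"
  shows "card S = (\<Sum>i<m. card {v. (v, i) \<in> S})"
proof -
  have "S = (\<lambda>(i, v). (v, i)) ` (SIGMA i:{..<m}. {v. (v, i) \<in> S})"
    using assms(2) by force
  then have "card S = card ((\<lambda>(i, v). (v, i)) ` (SIGMA i:{..<m}. {v. (v, i) \<in> S}))"
    by (rule arg_cong)
  also have "\<dots> = card (SIGMA i:{..<m}. {v. (v, i) \<in> S})"
    by (intro card_image) (auto simp: inj_on_def)
  also have "\<dots> = (\<Sum>i<m. card {v. (v, i) \<in> S})"
  proof (intro card_SigmaI ballI)
    show "finite {v. (v, i) \<in> S}" for i
      by (rule finite_subset[OF _ assms(1)]) (use assms(2) in auto)
  qed simp
  finally show ?thesis .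
qed

text \<open>
  Below, \<open>L i\<close> is the part of \<open>S\<close> in layer \<open>i\<close> and \<open>E\<close> the set of missed outer layers; each of the
  remaining \<open>m - 1 - card E\<close> outer layers contributes at least one vertex, so that only \<open>card E + 1\<close>
  further vertices have to be found.
\<close>

lemma decycling_set_product_star_ge:
  assumes T: "pair_graph T" "Digraph_Component.connected (with_proj T)"
    and n: "card (pverts T) = n" and m: "2 \<le> m" "m < n"
    and nostar: "\<not> digraph_iso (with_proj T) (with_proj (star n))"
    and S: "decycling_set (with_proj (T \<box> star m)) S"
  shows "m \<le> card S"
proof -
  interpret pair_graph T by fact
  define L where "L i = {v. (v, i) \<in> S}" for i
  define E where "E = {i \<in> {1..<m}. L i = {}}"
  have sub: "S \<subseteq> pverts T \<times> {..<m}" using S by (simp add: decycling_set_def)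
  then have L_sub: "L i \<subseteq> pverts T" for i by (auto simp: L_def)
  then have L_fin: "finite (L i)" for i using finite_subset pair_finite_verts by blast
  have cover_ge: "2 \<le> card C"
    if "C \<subseteq> pverts T" "\<And>u v. (u, v) \<in> parcs T \<Longrightarrow> u \<in> C \<or> v \<in> C" for C
  proof (rule ccontr)
    assume "\<not> 2 \<le> card C"
    then have "digraph_iso (with_proj T) (with_proj (star n))"
      using star_if_small_cover[OF T n _ finite_subset[OF that(1) pair_finite_verts] _ that] m
      by auto
    then show False using nostar by blast
  qed
  have covers: "u \<in> L 0 \<union> L i \<or> v \<in> L 0 \<union> L i" if "(u, v) \<in> parcs T" "i \<in> {1..<m}" for u v i
    using decycling_set_covers[OF T(1) S _ _ that(1), of i] that(2) by (auto simp: L_def)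
  have "{..<m} = insert 0 {1..<m}" using m by auto
  then have card_S: "card S = card (L 0) + (\<Sum>i\<in>{1..<m}. card (L i))"
    using card_eq_sum_card_layers[OF pair_finite_verts sub] by (simp add: L_def)
  have "card E \<le> m - 1" using card_mono[of "{1..<m}" E] unfolding E_def by force
  have hit: "m - 1 - card E \<le> (\<Sum>i\<in>{1..<m}. card (L i))"
  proof -
    have "m - 1 - card E = card ({1..<m} - E)"
      by (subst card_Diff_subset) (auto simp: E_def)
    also have "\<dots> = (\<Sum>i\<in>{1..<m} - E. 1)" by simp
    also have "\<dots> \<le> (\<Sum>i\<in>{1..<m} - E. card (L i))"
      by (rule sum_mono) (use L_fin in \<open>auto simp: E_def Suc_le_eq card_gt_0_iff\<close>)
    also have "\<dots> \<le> (\<Sum>i\<in>{1..<m}. card (L i))" by (rule sum_mono2) auto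
    finally show ?thesis .
  qed
  consider "card E = 0" | "card E = 1" | "2 \<le> card E" by linarith
  then show ?thesis
  proof cases
    case 1
    show ?thesis
    proof (cases "L 0 = {}")
      case True
      have "2 \<le> card (L i)" if "i \<in> {1..<m}" for i
        using cover_ge[OF L_sub[of i]] covers[OF _ that] True by auto
      then have "(\<Sum>i\<in>{1..<m}. 2) \<le> (\<Sum>i\<in>{1..<m}. card (L i))" by (intro sum_mono)
      then show ?thesis using card_S m by simp
    next
      case False
      then have "1 \<le> card (L 0)" using L_fin by (simp add: Suc_le_eq card_gt_0_iff)
      then show ?thesis using card_S hit 1 m by linarith
    qed
  next
    case 2
    then obtain i where "i \<in> {1..<m}" "L i = {}"
      by (metis (mono_tags, lifting) E_def card_1_singletonE insertI1 mem_Collect_eq)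
    then have "2 \<le> card (L 0)" using cover_ge[OF L_sub[of 0]] covers[of _ _ i] by auto
    then show ?thesis using card_S hit 2 m by linarith
  next
    case 3
    then obtain i j where ij: "i \<in> E" "j \<in> E" "i \<noteq> j"
      using card_le_Suc0_iff_eq[of E] by (fastforce simp: E_def)
    have "a = b" if "a \<in> pverts T - L 0" "b \<in> pverts T - L 0" for a b
      using decycling_set_two_missed_layers[OF T S, of i j a b] ij that
      by (auto simp: E_def L_def)
    then have "card (pverts T - L 0) \<le> 1" by (simp add: card_le_Suc0_iff_eq)
    then have "n - card (L 0) \<le> 1" using n L_sub L_fin by (simp add: card_Diff_subset)
    then show ?thesis using card_S m by linarith
  qed
qed

section \<open>The decycling number of the product of a tree and a star\<close>

theorem theorem4p1:
  fixes T :: "'a pair_pre_digraph" and n n' :: nat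
  assumes "2 \<le> n'" and "n' < n"
    and "undirected_tree (with_proj T)"
    and "card (pverts T) = n"
    and "\<not> digraph_iso (with_proj T) (with_proj (star n))"
  shows "n' \<le> decycling_number (with_proj (T \<box> star n'))
    \<and> decycling_number (with_proj (T \<box> star n')) \<le> n - 1"
proof
  have forest: "undirected_forest (with_proj T)"
    and conn: "Digraph_Component.connected (with_proj T)"
    using assms(3) by (auto simp: undirected_tree_def)
  have T: "pair_graph T"
    using forest by (auto simp: undirected_forest_def intro: pair_graphI_graph)
  then interpret pair_graph T .
  interpret P: pair_graph "T \<box> star n'"
    using pair_graph_cartesian_product[OF T pair_graph_star] assms(1) by simp
  obtain S where "decycling_set (with_proj (T \<box> star n')) S"
    "card S = decycling_number (with_proj (T \<box> star n'))"
    using P.decycling_number_attained by blast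
  then show "n' \<le> decycling_number (with_proj (T \<box> star n'))"
    using decycling_set_product_star_ge[OF T conn assms(4,1,2,5)] by metis
  have "pverts T \<noteq> {}" using assms by auto
  then obtain v where v: "v \<in> pverts T" by blast
  have "decycling_number (with_proj (T \<box> star n')) \<le> card ((pverts T - {v}) \<times> {0::nat})"
    using decycling_set_central_layer[OF T forest] assms(1) by (intro decycling_number_le_card) auto
  also have "\<dots> = n - 1" using v assms(4) by (simp add: card_cartesian_product)
  finally show "decycling_number (with_proj (T \<box> star n')) \<le> n - 1" .
qed

end
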